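(* Let $\mathcal{F}\subset\binom{[n]}{k}$ be a $t$-intersecting family. If $\tau_t(\mathcal{F})=t+1$ and $n\geq 2k-t+2$, then $\beta(\mathcal{F})\leq\binom{n-t-3}{k-t-2}$.
   Context: $\binom{[n]}{k}$ denotes the family of all $k$-element subsets of $[n]=\{1,\dots,n\}$. A family is $t$-intersecting if $|F\cap F'|\geq t$ for all members $F,F'$. A set $T\subset[n]$ is a $t$-transversal of $\mathcal{F}$ if $|T\cap F|\geq t$ for all $F\in\mathcal{F}$; $\tau_t(\mathcal{F})$ is the minimum size of a $t$-transversal of $\mathcal{F}$. For distinct $i,j\in[n]$, let $b_{ij}(\mathcal{F})=|\{F\in\mathcal{F}\colon i\in F,\ j\notin F\}|$; the sturdiness is $\beta(\mathcal{F})=\min_{1\leq i\neq j\leq n} b_{ij}(\mathcal{F})$. *)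

theory Defs imports Complex_Main begin

definition k_subsets :: "nat \<Rightarrow> nat \<Rightarrow> nat set set" where
  "k_subsets n k = {A. A \<subseteq> {1..n} \<and> card A = k}"

text \<open>The two members are not required to be distinct, so every member has at least t elements.\<close>
definition t_intersecting :: "nat \<Rightarrow> nat set set \<Rightarrow> bool" where
  "t_intersecting t \<F> \<longleftrightarrow> (\<forall>A\<in>\<F>. \<forall>B\<in>\<F>. t \<le> card (A \<inter> B))"

definition t_transversal :: "nat \<Rightarrow> nat \<Rightarrow> nat set set \<Rightarrow> nat set \<Rightarrow> bool" where
  "t_transversal n t \<F> T \<longleftrightarrow> T \<subseteq> {1..n} \<and> (\<forall>A\<in>\<F>. t \<le> card (T \<inter> A))"

text \<open>For a t-intersecting family of subsets of \<open>{1..n}\<close> the minimum is over a nonempty set,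
  because \<open>{1..n}\<close> itself is a t-transversal.\<close>
definition covering_number :: "nat \<Rightarrow> nat \<Rightarrow> nat set set \<Rightarrow> nat" where
  "covering_number n t \<F> = Min (card ` {T. t_transversal n t \<F> T})"

definition b :: "nat set set \<Rightarrow> nat \<Rightarrow> nat \<Rightarrow> nat" where
  "b \<F> i j = card {A \<in> \<F>. i \<in> A \<and> j \<notin> A}"

text \<open>The minimum is over a nonempty set if \<open>n \<ge> 2\<close>.\<close>
definition sturdiness :: "nat \<Rightarrow> nat set set \<Rightarrow> nat" where
  "sturdiness n \<F> = Min {b \<F> i j | i j. i \<in> {1..n} \<and> j \<in> {1..n} \<and> i \<noteq> j}"

text \<open>For \<open>m \<ge> 0\<close>, the binomial coefficient with the usual convention that it vanishes for a
  negative lower entry. With truncated subtraction of natural numbers a negative lower entry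
  would become 0 and the coefficient would become 1.\<close>
definition binom :: "int \<Rightarrow> int \<Rightarrow> nat" where
  "binom m r = (if r < 0 then 0 else nat m choose nat r)"

end

theory Submission imports Defs "HOL-Analysis.Convex" begin

text \<open>
Let T be a t-transversal with t + 1 elements, and for i \<in> T consider the traces F - T of the members F
avoiding i; such F contain all of T - {i}. For distinct i, j \<in> T the two trace families are
cross-intersecting and r-uniform, r = k - t, on m = n - t - 1 \<ge> 2r + 1 points, and b(x, i) is the degree
of x in the trace family of i. So the theorem reduces to a degree version of the Erdos-Ko-Rado theorem
in the style of Huang and Zhao: one of two cross-intersecting families has a vertex of degree at most
that of a non-central vertex of a star.

This is proved with the Kneser graph. An indicator function is split into its constant part, its linear
part (given by the degrees) and a residual h orthogonal to both, on which the Kneser operator has norm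
at most binom(m-r-2, r-2). The latter needs no spectral decomposition: up to sign, taking differences
h(U + x) - h(U + y) intertwines the Kneser operators on m and on m - 2 points, so the second differences
of the iterates grow at most like powers of binom(m-r-2, r-2); these control the iterates because h is
orthogonal to linear functions, and self-adjointness turns the growth rate into a norm bound.
The resulting inequality is bilinear in the sizes of the two families once the degrees are bounded
below, so it suffices to look at extreme points, with equality for two equal stars.
\<close>

subsection \<open>The Kneser operator on uniform families\<close>

definition ksub :: "'a set \<Rightarrow> nat \<Rightarrow> 'a set set" where
  "ksub X r = {S. S \<subseteq> X \<and> card S = r}"

definition kneser :: "'a set \<Rightarrow> nat \<Rightarrow> ('a set \<Rightarrow> real) \<Rightarrow> 'a set \<Rightarrow> real" where
  "kneser X r h S = sum h (ksub (X - S) r)"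

text \<open>Derivative along the exchange of x and y: it turns a function on r-sets of X into one on
  (r - 1)-subsets of X - {x, y}.\<close>

definition diff :: "'a \<Rightarrow> 'a \<Rightarrow> ('a set \<Rightarrow> real) \<Rightarrow> 'a set \<Rightarrow> real" where
  "diff x y h U = h (insert x U) - h (insert y U)"

definition deg :: "'a set \<Rightarrow> nat \<Rightarrow> ('a set \<Rightarrow> real) \<Rightarrow> 'a \<Rightarrow> real" where
  "deg X r h x = sum h {S \<in> ksub X r. x \<in> S}"

definition inner_ksub :: "'a set \<Rightarrow> nat \<Rightarrow> ('a set \<Rightarrow> real) \<Rightarrow> ('a set \<Rightarrow> real) \<Rightarrow> real" where
  "inner_ksub X r f g = (\<Sum>S\<in>ksub X r. f S * g S)"

text \<open>For 1 \<le> r \<le> card X / 2 this is the sum of the eigenspaces of index at least 2 of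
  the Johnson scheme.\<close>

definition orth_linear :: "'a set \<Rightarrow> nat \<Rightarrow> ('a set \<Rightarrow> real) \<Rightarrow> bool" where
  "orth_linear X r h \<longleftrightarrow> sum h (ksub X r) = 0 \<and> (\<forall>c. inner_ksub X r (sum c) h = 0)"

lemma finite_ksub [simp]: "finite X \<Longrightarrow> finite (ksub X r)"
  unfolding ksub_def by (rule finite_subset[of _ "Pow X"]) auto

lemma card_ksub: "finite X \<Longrightarrow> card (ksub X r) = card X choose r"
  unfolding ksub_def by (rule n_subsets)

lemma ksub_containing:
  assumes "finite X" "x \<in> X"
  shows "bij_betw (insert x) (ksub (X - {x}) r) {S \<in> ksub X (Suc r). x \<in> S}"
proof (rule bij_betw_byWitness[where f' = "\<lambda>S. S - {x}"])
  show "insert x ` ksub (X - {x}) r \<subseteq> {S \<in> ksub X (Suc r). x \<in> S}"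
  proof safe
    fix U assume "U \<in> ksub (X - {x}) r"
    moreover from this have "finite U" using assms by (auto simp: ksub_def intro: finite_subset)
    ultimately show "insert x U \<in> ksub X (Suc r)" using assms by (auto simp: ksub_def card_insert_if)
  qed
  show "(\<lambda>S. S - {x}) ` {S \<in> ksub X (Suc r). x \<in> S} \<subseteq> ksub (X - {x}) r"
    by (auto simp: ksub_def)
  show "\<forall>U\<in>ksub (X - {x}) r. insert x U - {x} = U" by (auto simp: ksub_def)
  show "\<forall>S\<in>{S \<in> ksub X (Suc r). x \<in> S}. insert x (S - {x}) = S" by auto
qed

lemma deg_Suc:
  assumes "finite X" "x \<in> X"
  shows "deg X (Suc r) h x = (\<Sum>U\<in>ksub (X - {x}) r. h (insert x U))"
  unfolding deg_def using sum.reindex_bij_betw[OF ksub_containing[OF assms], of h] by simp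

lemma sum_ksub_Suc:
  assumes "finite X" "x \<in> X"
  shows "sum (h :: 'a set \<Rightarrow> real) (ksub X (Suc r)) = (\<Sum>U\<in>ksub (X - {x}) r. h (insert x U)) + sum h (ksub (X - {x}) (Suc r))"
proof -
  have "ksub X (Suc r) = {S \<in> ksub X (Suc r). x \<in> S} \<union> ksub (X - {x}) (Suc r)"
    by (auto simp: ksub_def)
  moreover have "{S \<in> ksub X (Suc r). x \<in> S} \<inter> ksub (X - {x}) (Suc r) = {}"
    by (auto simp: ksub_def)
  ultimately have "sum h (ksub X (Suc r)) = sum h {S \<in> ksub X (Suc r). x \<in> S} + sum h (ksub (X - {x}) (Suc r))"
    using assms by (metis (no_types, lifting) finite_ksub finite_Un sum.union_disjoint)
  then show ?thesis using deg_Suc[OF assms, of r h] by (simp add: deg_def)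
qed

section \<open>Linear functions, degrees and the Kneser operator\<close>

lemma inner_ksub_sum:
  assumes "finite X"
  shows "inner_ksub X r (sum c) h = (\<Sum>x\<in>X. c x * deg X r h x)"
proof -
  have "inner_ksub X r (sum c) h = (\<Sum>S\<in>ksub X r. \<Sum>x\<in>{x\<in>X. x \<in> S}. c x * h S)"
    unfolding inner_ksub_def sum_distrib_right
    by (intro sum.cong refl) (auto simp: ksub_def)
  also have "\<dots> = (\<Sum>x\<in>X. \<Sum>S\<in>{S\<in>ksub X r. x \<in> S}. c x * h S)"
    by (rule sum.swap_restrict) (use assms in auto)
  finally show ?thesis by (simp add: deg_def sum_distrib_left)
qed

lemma deg_const:
  assumes "finite X" "x \<in> X"
  shows "deg X (Suc r) (\<lambda>_. a) x = a * real ((card X - 1) choose r)"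
  using assms by (simp add: deg_Suc card_ksub)

lemma sum_sum_ksub:
  assumes "finite X"
  shows "(\<Sum>S\<in>ksub X (Suc r). sum c S) = real ((card X - 1) choose r) * (sum c X)"
proof -
  have "(\<Sum>S\<in>ksub X (Suc r). sum c S) = inner_ksub X (Suc r) (sum c) (\<lambda>_. 1)"
    by (simp add: inner_ksub_def)
  also have "\<dots> = real ((card X - 1) choose r) * (sum c X)"
    using assms by (simp add: inner_ksub_sum deg_const sum_distrib_right mult.commute[of _ "sum c X"] cong: sum.cong)
  finally show ?thesis .
qed

text \<open>Every point outside S lies in equally many of the sets summed over. When c sums to zero
  on X, \<open>sum c\<close> is thus an eigenvector with eigenvalue minus this binomial
  coefficient.\<close>

lemma kneser_sum:
  assumes "finite X" "S \<in> ksub X (Suc r)"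
  shows "kneser X (Suc r) (sum c) S = real ((card X - Suc r - 1) choose r) * (sum c X - sum c S)"
proof -
  have "S \<subseteq> X" "card S = Suc r" using assms by (auto simp: ksub_def)
  then show ?thesis
    using assms finite_subset[of S X]
    by (simp add: kneser_def sum_sum_ksub card_Diff_subset sum_diff)
qed

lemma kneser_const:
  assumes "finite X" "S \<in> ksub X r"
  shows "kneser X r (\<lambda>_. a) S = real ((card X - r) choose r) * a"
proof -
  have "S \<subseteq> X" "card S = r" using assms by (auto simp: ksub_def)
  then show ?thesis
    using assms finite_subset[of S X]
    by (simp add: kneser_def card_ksub card_Diff_subset)
qed

text \<open>Every set through x counts c x, and every other point is counted binom(card X - 2, r)
  times. These other points total - c x, and Pascal's rule gives the difference of the two
  coefficients.\<close>

lemma deg_sum: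
  assumes "finite X" "x \<in> X" "sum c X = 0"
  shows "deg X (Suc (Suc r)) (sum c) x = c x * real ((card X - 2) choose Suc r)"
proof -
  have fU: "finite U \<and> x \<notin> U" if "U \<in> ksub (X - {x}) (Suc r)" for U
    using that assms(1) by (auto simp: ksub_def intro: finite_subset)
  have cX: "card X \<ge> 1" using assms by (simp add: Suc_le_eq card_gt_0_iff) blast
  have "deg X (Suc (Suc r)) (sum c) x = (\<Sum>U\<in>ksub (X - {x}) (Suc r). c x + sum c U)"
    using assms fU by (simp add: deg_Suc)
  also have "\<dots> = real ((card X - 1) choose Suc r) * c x + real ((card X - 2) choose r) * (- c x)"
    using assms by (simp add: sum.distrib card_ksub sum_sum_ksub sum_diff numeral_2_eq_2)
  also have "\<dots> = c x * real ((card X - 2) choose Suc r)"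
  \<comment> \<open>For a one-point X the truncated \<open>card X - 2\<close> breaks Pascal's rule,
    but there c x = 0.\<close>
  proof (cases "card X = 1")
    case False
    then have "card X - 1 = Suc (card X - 2)" using cX by simp
    then have "real ((card X - 1) choose Suc r) = real ((card X - 2) choose Suc r) + real ((card X - 2) choose r)"
      by (simp add: binomial_Suc_Suc)
    then show ?thesis by (simp add: algebra_simps)
  next
    case True
    then have "X = {x}" using assms(2) by (metis card_1_singletonE singletonD)
    then show ?thesis using assms by simp
  qed
  finally show ?thesis .
qed

lemma kneser_adjoint:
  assumes "finite X"
  shows "inner_ksub X r f (kneser X r g) = inner_ksub X r (kneser X r f) g"
proof -
  have "inner_ksub X r f (kneser X r g) = (\<Sum>S\<in>ksub X r. \<Sum>T\<in>{T\<in>ksub X r. S \<inter> T = {}}. f S * g T)"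
    unfolding inner_ksub_def kneser_def sum_distrib_left
    by (intro sum.cong refl) (auto simp: ksub_def)
  also have "\<dots> = (\<Sum>T\<in>ksub X r. \<Sum>S\<in>{S\<in>ksub X r. S \<inter> T = {}}. f S * g T)"
    by (rule sum.swap_restrict) (use assms in auto)
  also have "\<dots> = inner_ksub X r (kneser X r f) g"
    unfolding inner_ksub_def kneser_def sum_distrib_right
    by (intro sum.cong refl) (auto simp: ksub_def)
  finally show ?thesis .
qed

lemma orth_linear_deg:
  assumes "finite X" "orth_linear X r h" "x \<in> X"
  shows "deg X r h x = 0"
proof -
  have "0 = inner_ksub X r (sum (\<lambda>y. of_bool (y = x))) h" using assms by (simp add: orth_linear_def)
  also have "\<dots> = deg X r h x" using assms by (simp add: inner_ksub_sum sum.delta of_bool_def if_distrib[of "\<lambda>u. u * _"] cong: if_cong)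
  finally show ?thesis by simp
qed

text \<open>Self-adjointness moves the operator onto constants and linear functions, whose span it
  preserves. This allows iteration on the orthogonal complement.\<close>

lemma orth_linear_kneser:
  assumes "finite X" "orth_linear X (Suc r) h"
  shows "orth_linear X (Suc r) (kneser X (Suc r) h)"
proof -
  have s: "sum h (ksub X (Suc r)) = 0" and l: "\<And>c. inner_ksub X (Suc r) (sum c) h = 0"
    using assms by (auto simp: orth_linear_def)
  have "sum (kneser X (Suc r) h) (ksub X (Suc r)) = inner_ksub X (Suc r) (\<lambda>_. 1) (kneser X (Suc r) h)"
    by (simp add: inner_ksub_def)
  also have "\<dots> = (\<Sum>S\<in>ksub X (Suc r). real ((card X - Suc r) choose Suc r) * h S)"
    unfolding kneser_adjoint[OF assms(1)] unfolding inner_ksub_def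
    by (intro sum.cong refl) (use assms(1) in \<open>simp add: kneser_const\<close>)
  also have "\<dots> = 0" using s by (simp flip: sum_distrib_left)
  finally have 1: "sum (kneser X (Suc r) h) (ksub X (Suc r)) = 0" .
  have "inner_ksub X (Suc r) (sum c) (kneser X (Suc r) h) = 0" for c
  proof -
    let ?C = "real ((card X - Suc r - 1) choose r)"
    have "inner_ksub X (Suc r) (sum c) (kneser X (Suc r) h) = (\<Sum>S\<in>ksub X (Suc r). ?C * sum c X * h S - ?C * (sum c S * h S))"
      unfolding kneser_adjoint[OF assms(1)] unfolding inner_ksub_def
      by (intro sum.cong refl) (use assms(1) in \<open>simp add: kneser_sum algebra_simps\<close>)
    also have "\<dots> = ?C * sum c X * sum h (ksub X (Suc r)) - ?C * inner_ksub X (Suc r) (sum c) h"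
      by (simp add: sum_subtractf sum_distrib_left inner_ksub_def)
    finally show ?thesis using s l by simp
  qed
  with 1 show ?thesis by (simp add: orth_linear_def)
qed

section \<open>Exchange differences under the Kneser operator\<close>

lemma diff_kneser:
  assumes "finite X" "x \<in> X" "y \<in> X" "x \<noteq> y" "S \<subseteq> X - {x, y}"
  shows "diff x y (kneser X (Suc r) h) S = - kneser (X - {x, y}) r (diff x y h) S"
proof -
  let ?Y = "X - {x, y} - S"
  \<comment> \<open>Sets avoiding \<open>insert u S\<close> either contain v or avoid both u and v.
    The second kind is common to both terms of the difference and cancels; the first kind has the
    roles of x and y exchanged, whence the minus sign.\<close>
  have *: "kneser X (Suc r) h (insert u S) = (\<Sum>U\<in>ksub ?Y r. h (insert v U)) + sum h (ksub ?Y (Suc r))"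
    if "{u, v} = {x, y}" for u v
  proof -
    have "u \<noteq> v" "{u, v} = {x, y}" using that assms(4) by (auto simp: doubleton_eq_iff)
    then have e: "X - insert u S = insert v ?Y" and v: "v \<notin> ?Y" and "insert v ?Y - {v} = ?Y"
      using assms by (auto simp: doubleton_eq_iff)
    then show ?thesis
      unfolding kneser_def e using sum_ksub_Suc[of "insert v ?Y" v h r] assms(1) by simp
  qed
  show ?thesis
    unfolding diff_def *[of x y, OF refl] *[of y x, OF insert_commute]
    by (simp add: kneser_def sum_subtractf)
qed

text \<open>The two signs cancel. The rank falls by two and four points disappear, so the remaining
  Kneser graph has degree binom(m - r - 2, r - 2) in terms of the original m points and rank
  r.\<close>

lemma diff_diff_kneser:
  assumes "finite X" "x \<in> X" "y \<in> X" "x \<noteq> y"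
    and "z \<in> X - {x, y}" "w \<in> X - {x, y}" "z \<noteq> w" "U \<subseteq> X - {x, y} - {z, w}"
  shows "diff z w (diff x y (kneser X (Suc (Suc r)) h)) U
       = kneser (X - {x, y} - {z, w}) r (diff z w (diff x y h)) U"
proof -
  have "diff z w (diff x y (kneser X (Suc (Suc r)) h)) U
      = - diff z w (kneser (X - {x, y}) (Suc r) (diff x y h)) U"
    using assms by (subst (1 2) diff_def) (subst (1 2) diff_kneser; auto)
  also have "\<dots> = kneser (X - {x, y} - {z, w}) r (diff z w (diff x y h)) U"
    using assms by (simp add: diff_kneser)
  finally show ?thesis .
qed

lemma kneser_bound:
  assumes "finite X" "S \<in> ksub X r" "\<And>U. U \<in> ksub X r \<Longrightarrow> \<bar>h U\<bar> \<le> c"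
  shows "\<bar>kneser X r h S\<bar> \<le> real ((card X - r) choose r) * c"
proof -
  have "S \<subseteq> X" "card S = r" using assms by (auto simp: ksub_def)
  have "\<bar>kneser X r h S\<bar> \<le> (\<Sum>U\<in>ksub (X - S) r. \<bar>h U\<bar>)"
    unfolding kneser_def by (rule sum_abs)
  also have "\<dots> \<le> (\<Sum>U\<in>ksub (X - S) r. c)"
    by (intro sum_mono assms(3)) (auto simp: ksub_def)
  also have "\<dots> = real ((card X - r) choose r) * c"
    using assms(1) \<open>S \<subseteq> X\<close> \<open>card S = r\<close> finite_subset[of S X]
    by (simp add: card_ksub card_Diff_subset)
  finally show ?thesis .
qed

section \<open>From differences back to values: a discrete Poincare inequality\<close>

lemma ksub_path_bound:
  assumes "finite X" "S \<in> ksub X (Suc r)" "T \<in> ksub X (Suc r)"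
    and "\<And>x y U. x \<in> X \<Longrightarrow> y \<in> X \<Longrightarrow> x \<noteq> y \<Longrightarrow> U \<in> ksub (X - {x, y}) r \<Longrightarrow> \<bar>diff x y h U\<bar> \<le> c"
  shows "\<bar>h S - h T\<bar> \<le> real (card (S - T)) * c"
  using assms(2)
proof (induction "card (S - T)" arbitrary: S)
  case 0
  then have fin: "finite S" "finite T" and cs: "card S = card T"
    using assms by (auto simp: ksub_def intro: finite_subset)
  with 0 have "S \<subseteq> T" by (metis Diff_eq_empty_iff card_0_eq finite_Diff)
  then have "S = T" using card_subset_eq fin cs by metis
  then show ?case by simp
next
  case (Suc n)
  have fin: "finite S" "finite T" and sub: "S \<subseteq> X" "T \<subseteq> X" and cs: "card S = Suc r" "card T = Suc r"
    using assms Suc.prems by (auto simp: ksub_def intro: finite_subset)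
  from Suc.hyps(2) have "S - T \<noteq> {}" by (metis card.empty nat.distinct(1))
  then obtain x where x: "x \<in> S" "x \<notin> T" by auto
  have "card (T - S) = card (S - T)"
    using cs fin by (metis Int_commute card_Diff_subset_Int finite_Int)
  with Suc.hyps(2) have "T - S \<noteq> {}" by (metis card.empty nat.distinct(1))
  then obtain y where y: "y \<in> T" "y \<notin> S" by auto
  \<comment> \<open>Exchanging x for y is one step of a path from S to T; it costs at most c and
    shrinks S - T by one element.\<close>
  let ?U = "S - {x}"
  have U: "?U \<in> ksub (X - {x, y}) r" using sub x y cs fin by (auto simp: ksub_def)
  have S': "insert y ?U \<in> ksub X (Suc r)" using sub x y cs fin by (auto simp: ksub_def)
  have "insert y ?U - T = (S - T) - {x}" using x y by auto
  then have "n = card (insert y ?U - T)" using Suc.hyps(2) x fin by simp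
  then have "\<bar>h (insert y ?U) - h T\<bar> \<le> real n * c" using Suc.hyps(1) S' by blast
  moreover have "\<bar>h S - h (insert y ?U)\<bar> \<le> c"
    using assms(4)[OF _ _ _ U] x y sub by (auto simp: diff_def insert_absorb)
  ultimately have "\<bar>h S - h T\<bar> \<le> real (Suc n) * c" by (simp add: algebra_simps)
  then show ?case using Suc.hyps(2) by simp
qed

text \<open>As h has mean zero, h S is the average over T of h S - h T, and each of these is bounded
  along a path of at most \<open>Suc r\<close> exchanges.\<close>

lemma poincare:
  assumes "finite X" "S \<in> ksub X (Suc r)" "sum h (ksub X (Suc r)) = 0"
    and "\<And>x y U. x \<in> X \<Longrightarrow> y \<in> X \<Longrightarrow> x \<noteq> y \<Longrightarrow> U \<in> ksub (X - {x, y}) r \<Longrightarrow> \<bar>diff x y h U\<bar> \<le> c"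
    and "c \<ge> 0"
  shows "\<bar>h S\<bar> \<le> real (Suc r) * c"
proof -
  let ?P = "ksub X (Suc r)"
  have N: "card ?P > 0" using assms by (auto simp: card_gt_0_iff)
  have "real (card ?P) * h S = (\<Sum>T\<in>?P. h S - h T)"
    using assms(3) by (simp add: sum_subtractf)
  then have "real (card ?P) * \<bar>h S\<bar> = \<bar>\<Sum>T\<in>?P. h S - h T\<bar>"
    by (metis abs_mult abs_of_nat)
  also have "\<dots> \<le> (\<Sum>T\<in>?P. \<bar>h S - h T\<bar>)" by (rule sum_abs)
  also have "\<dots> \<le> (\<Sum>T\<in>?P. real (Suc r) * c)"
  proof (rule sum_mono)
    fix T assume T: "T \<in> ?P"
    have "card (S - T) \<le> Suc r"
      using assms(1,2) by (metis (mono_tags, lifting) Diff_subset card_mono finite_subset ksub_def mem_Collect_eq)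
    then have "real (card (S - T)) * c \<le> real (Suc r) * c"
      using assms(5) by (intro mult_right_mono) auto
    then show "\<bar>h S - h T\<bar> \<le> real (Suc r) * c"
      using ksub_path_bound[OF assms(1,2) T, of h c] assms(4) by force
  qed
  also have "\<dots> = real (card ?P) * (real (Suc r) * c)" by simp
  finally show ?thesis using N by simp
qed

text \<open>The sum is the degree of x minus the degree of y, as sets containing both points cancel;
  both degrees vanish. So differences again have mean zero and \<open>poincare\<close> applies a
  second time.\<close>

lemma sum_diff_eq_0:
  assumes "finite X" "orth_linear X (Suc r) h" "x \<in> X" "y \<in> X" "x \<noteq> y"
  shows "sum (diff x y h) (ksub (X - {x, y}) r) = 0"
proof (cases r)
  case 0
  then have d: "deg X (Suc 0) h x = 0" "deg X (Suc 0) h y = 0"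
    using assms orth_linear_deg by metis+
  have e: "ksub Y 0 = {{}}" if "finite Y" for Y :: "'a set"
    using that by (auto simp: ksub_def dest: finite_subset)
  from d show ?thesis using 0 assms by (simp add: deg_Suc e diff_def)
next
  case (Suc s)
  let ?Y = "X - {x, y}"
  have *: "deg X (Suc (Suc s)) h u = (\<Sum>U\<in>ksub ?Y s. h (insert u (insert v U))) + (\<Sum>U\<in>ksub ?Y (Suc s). h (insert u U))"
    if "{u, v} = {x, y}" for u v
  proof -
    have "u \<noteq> v" "u \<in> X" "v \<in> X" and e: "X - {u} - {v} = ?Y"
      using that assms by (auto simp: doubleton_eq_iff)
    then show ?thesis using assms(1) sum_ksub_Suc[of "X - {u}" v "\<lambda>U. h (insert u U)" s]
      by (simp add: deg_Suc e)
  qed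
  have "deg X (Suc (Suc s)) h x = 0" "deg X (Suc (Suc s)) h y = 0"
    using assms Suc orth_linear_deg by metis+
  then show ?thesis
    using *[of x y, OF refl] *[of y x, OF insert_commute] Suc
    by (simp add: diff_def sum_subtractf insert_commute)
qed

subsection \<open>Norm bound on functions orthogonal to linear functions\<close>

text \<open>Log-convexity makes the ratios of consecutive terms nondecreasing. If the first ratio
  exceeded L, the sequence would outgrow C L^n, however large C is.\<close>

lemma log_convex_geometric_bound:
  fixes a :: "nat \<Rightarrow> real"
  assumes nonneg: "\<And>n. a n \<ge> 0"
    and convex: "\<And>n. (a (Suc n))\<^sup>2 \<le> a n * a (Suc (Suc n))"
    and bound: "\<And>n. a n \<le> C * L ^ n" and "L > 0"
  shows "a 1 \<le> L * a 0"
proof (rule ccontr)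
  assume "\<not> a 1 \<le> L * a 0"
  then have gt: "a 1 > L * a 0" by simp
  have "a 0 \<noteq> 0"
  proof
    assume "a 0 = 0"
    then have "(a 1)\<^sup>2 \<le> 0" using convex[of 0] by simp
    then show False using gt \<open>a 0 = 0\<close> by simp
  qed
  then have pos: "a 0 > 0" using nonneg[of 0] by simp
  define \<theta> where "\<theta> = a 1 / a 0"
  have \<theta>: "\<theta> > L" using gt pos by (simp add: \<theta>_def field_simps)
  have step: "a n > 0 \<and> a (Suc n) \<ge> \<theta> * a n" for n
  proof (induction n)
    case 0
    then show ?case using pos by (simp add: \<theta>_def)
  next
    case (Suc n)
    have p: "a (Suc n) > 0"
      using Suc \<theta> \<open>L > 0\<close> by (meson less_le_trans less_trans mult_pos_pos)
    have "a n * (\<theta> * a (Suc n)) \<le> a (Suc n) * a (Suc n)"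
      using Suc p by (simp add: mult.assoc[symmetric] mult.commute[of "a n"] mult_right_mono)
    also have "\<dots> \<le> a n * a (Suc (Suc n))"
      using convex[of n] by (simp add: power2_eq_square)
    finally show ?case using Suc p by simp
  qed
  have low: "a 0 * \<theta> ^ n \<le> a n" for n
  proof (induction n)
    case (Suc n)
    have "a 0 * \<theta> ^ Suc n \<le> \<theta> * a n"
      using Suc \<theta> \<open>L > 0\<close> by (simp add: mult.left_commute)
    then show ?case using step[of n] by linarith
  qed simp
  obtain n where "C / a 0 < (\<theta> / L) ^ n"
    using real_arch_pow[of "\<theta> / L"] \<theta> \<open>L > 0\<close> by auto
  then have "C * L ^ n < a 0 * \<theta> ^ n"
    using pos \<open>L > 0\<close> by (simp add: field_simps power_divide)
  with low[of n] bound[of n] show False by linarith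
qed

text \<open>By \<open>diff_diff_kneser\<close> each iteration costs at most the degree of the Kneser
  graph on s-sets of card X - 4 points. The factor 4 counts the values of h in one second
  difference.\<close>

lemma diff_diff_kneser_funpow_bound:
  assumes "finite X" "x \<in> X" "y \<in> X" "x \<noteq> y"
    and "z \<in> X - {x, y}" "w \<in> X - {x, y}" "z \<noteq> w" "U \<in> ksub (X - {x, y} - {z, w}) s"
  shows "\<bar>diff z w (diff x y ((kneser X (Suc (Suc s)) ^^ n) h)) U\<bar>
       \<le> 4 * (\<Sum>S\<in>ksub X (Suc (Suc s)). \<bar>h S\<bar>) * real ((card X - s - 4) choose s) ^ n"
  using assms(8)
proof (induction n arbitrary: U)
  case 0
  have "finite U" using assms(1) 0 by (auto simp: ksub_def intro: finite_subset)
  have "\<bar>h (insert u (insert v U))\<bar> \<le> (\<Sum>S\<in>ksub X (Suc (Suc s)). \<bar>h S\<bar>)"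
    if "u \<in> {x, y}" "v \<in> {z, w}" for u v
  proof (rule member_le_sum)
    show "insert u (insert v U) \<in> ksub X (Suc (Suc s))"
      using 0 that assms(2-7) \<open>finite U\<close> by (auto simp: ksub_def card_insert_if)
  qed (use assms(1) in auto)
  from this[of x z] this[of x w] this[of y z] this[of y w]
  show ?case unfolding diff_def by simp
next
  case (Suc n)
  let ?Y = "X - {x, y} - {z, w}"
  have "card ?Y = card X - 4"
    using assms(1-7) by (simp add: card_Diff_subset)
  moreover have "U \<subseteq> ?Y" using Suc.prems by (simp add: ksub_def)
  ultimately show ?case
    using kneser_bound[OF _ Suc.prems Suc.IH] assms(1)
    by (simp add: diff_diff_kneser[OF assms(1-7)] algebra_simps)
qed

lemma kneser_norm_bound:
  assumes "finite X" "orth_linear X (Suc (Suc s)) h" "2 * Suc (Suc s) \<le> card X"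
  defines "K \<equiv> kneser X (Suc (Suc s))"
  shows "inner_ksub X (Suc (Suc s)) (K h) (K h)
       \<le> (real ((card X - s - 4) choose s))\<^sup>2 * inner_ksub X (Suc (Suc s)) h h"
proof -
  let ?r = "Suc (Suc s)"
  define L where "L = real ((card X - s - 4) choose s)"
  define c where "c = 4 * (\<Sum>S\<in>ksub X ?r. \<bar>h S\<bar>)"
  define k where "k n = (K ^^ n) h" for n
  define a where "a n = inner_ksub X ?r (k n) (k n)" for n
  have "L > 0" using assms(3) by (simp add: L_def)
  have "c \<ge> 0" by (simp add: c_def sum_nonneg)
  have orth: "orth_linear X ?r (k n)" for n
  proof (induction n)
    case 0
    then show ?case using assms(2) by (simp add: k_def)
  next
    case (Suc n)
    then show ?case using orth_linear_kneser[OF assms(1) Suc] by (simp add: k_def K_def)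
  qed
  \<comment> \<open>Two uses of \<open>poincare\<close> lead from second differences to first
    differences to values. Only the rate L matters; the constants vanish in the growth
    argument.\<close>
  have sup: "\<bar>k n S\<bar> \<le> real ?r * (real (Suc s) * (c * L ^ n))" if S: "S \<in> ksub X ?r" for n S
  proof (rule poincare[OF assms(1) S, where c = "real (Suc s) * (c * L ^ n)"])
    fix x y U assume xy: "x \<in> X" "y \<in> X" "x \<noteq> y" and U: "U \<in> ksub (X - {x, y}) (Suc s)"
    show "\<bar>diff x y (k n) U\<bar> \<le> real (Suc s) * (c * L ^ n)"
    proof (rule poincare[OF _ U, where c = "c * L ^ n"])
      show "sum (diff x y (k n)) (ksub (X - {x, y}) (Suc s)) = 0"
        by (rule sum_diff_eq_0[OF assms(1) orth xy])
      fix z w V assume "z \<in> X - {x, y}" "w \<in> X - {x, y}" "z \<noteq> w" "V \<in> ksub (X - {x, y} - {z, w}) s"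
      then show "\<bar>diff z w (diff x y (k n)) V\<bar> \<le> c * L ^ n"
        using diff_diff_kneser_funpow_bound[OF assms(1) xy] by (simp add: k_def c_def L_def K_def)
    qed (use assms(1) \<open>c \<ge> 0\<close> \<open>L > 0\<close> in auto)
  qed (use orth \<open>c \<ge> 0\<close> \<open>L > 0\<close> in \<open>auto simp: orth_linear_def\<close>)
  define C where "C = real (card (ksub X ?r)) * (real ?r * (real (Suc s) * c))\<^sup>2"
  have "a n \<le> C * (L\<^sup>2) ^ n" for n
  proof -
    have "a n \<le> (\<Sum>S\<in>ksub X ?r. (real ?r * (real (Suc s) * (c * L ^ n)))\<^sup>2)"
      unfolding a_def inner_ksub_def power2_eq_square[symmetric]
      by (intro sum_mono) (use sup in \<open>metis abs_ge_zero power2_abs power_mono\<close>)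
    also have "\<dots> = C * (L\<^sup>2) ^ n"
      by (simp add: C_def power_mult_distrib power_mult[symmetric] mult.commute[of 2] del: of_nat_Suc)
    finally show ?thesis .
  qed
  \<comment> \<open>Moving one operator across the inner product turns the squared norm of
    \<open>k (Suc n)\<close> into the product of its two neighbours, and Cauchy-Schwarz gives
    log-convexity.\<close>
  moreover have "(a (Suc n))\<^sup>2 \<le> a n * a (Suc (Suc n))" for n
  proof -
    have "a (Suc n) = inner_ksub X ?r (k n) (k (Suc (Suc n)))"
      using kneser_adjoint[OF assms(1), of ?r "k n" "k (Suc n)"] by (simp add: a_def k_def K_def)
    then show ?thesis
      using Cauchy_Schwarz_ineq_sum[of "k n" "k (Suc (Suc n))" "ksub X ?r"]
      by (simp add: a_def inner_ksub_def power2_eq_square)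
  qed
  moreover have "a n \<ge> 0" for n by (simp add: a_def inner_ksub_def sum_nonneg)
  ultimately have "a 1 \<le> L\<^sup>2 * a 0"
    using \<open>L > 0\<close> log_convex_geometric_bound[of a C "L\<^sup>2"] by simp
  then show ?thesis by (simp add: a_def k_def L_def)
qed

text \<open>Expanding the squared norm of l f + K g, with K the Kneser operator, gives the bound.
  The parameter l may exceed the norm bound, which is exploited later with two different
  values.\<close>

lemma kneser_form_bound:
  assumes "finite X" "orth_linear X (Suc (Suc s)) f" "orth_linear X (Suc (Suc s)) g"
    "2 * Suc (Suc s) \<le> card X" "real ((card X - s - 4) choose s) \<le> l"
  shows "- (l / 2) * (inner_ksub X (Suc (Suc s)) f f + inner_ksub X (Suc (Suc s)) g g)
    \<le> inner_ksub X (Suc (Suc s)) f (kneser X (Suc (Suc s)) g)"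
proof -
  let ?r = "Suc (Suc s)" and ?L = "real ((card X - s - 4) choose s)"
  let ?k = "kneser X ?r g"
  have L: "?L > 0" using assms(4) by simp
  then have l: "l > 0" using assms(5) by linarith
  have "0 \<le> (\<Sum>S\<in>ksub X ?r. (l * f S + ?k S)\<^sup>2)" by (rule sum_nonneg) simp
  also have "\<dots> = l\<^sup>2 * inner_ksub X ?r f f + 2 * l * inner_ksub X ?r f ?k + inner_ksub X ?r ?k ?k"
    by (simp add: inner_ksub_def sum.distrib sum_distrib_left power2_eq_square algebra_simps)
  also have "inner_ksub X ?r ?k ?k \<le> ?L\<^sup>2 * inner_ksub X ?r g g"
    using kneser_norm_bound assms by blast
  also have "\<dots> \<le> l\<^sup>2 * inner_ksub X ?r g g"
    using assms(5) L by (intro mult_right_mono power_mono) (auto simp: inner_ksub_def sum_nonneg)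
  finally have "0 \<le> l * (l * (inner_ksub X ?r f f + inner_ksub X ?r g g) + 2 * inner_ksub X ?r f ?k)"
    by (simp add: power2_eq_square algebra_simps)
  then have "0 \<le> l * (inner_ksub X ?r f f + inner_ksub X ?r g g) + 2 * inner_ksub X ?r f ?k"
    using l by (simp add: zero_le_mult_iff)
  then show ?thesis by (simp add: field_simps)
qed

subsection \<open>Splitting off the linear part\<close>

text \<open>The linear part of f on r-sets is the function \<open>sum c\<close> with c given by \<open>lin_coeff\<close>; the denominator
is the factor by which taking degrees scales a c of sum zero (see \<open>deg_sum\<close>).\<close>
definition lin_coeff :: "'a set \<Rightarrow> nat \<Rightarrow> ('a set \<Rightarrow> real) \<Rightarrow> 'a \<Rightarrow> real" where
  "lin_coeff X r f x = (deg X r f x - real r * sum f (ksub X r) / real (card X))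
     / real ((card X - 2) choose (r - 1))"

definition lin_residual :: "'a set \<Rightarrow> nat \<Rightarrow> ('a set \<Rightarrow> real) \<Rightarrow> 'a set \<Rightarrow> real" where
  "lin_residual X r f S = f S - sum f (ksub X r) / real (card X choose r) - sum (lin_coeff X r f) S"

lemma sum_deg:
  assumes "finite X"
  shows "(\<Sum>x\<in>X. deg X r f x) = real r * sum f (ksub X r)"
proof -
  have "(\<Sum>x\<in>X. deg X r f x) = inner_ksub X r (sum (\<lambda>_. 1)) f"
    using inner_ksub_sum[OF assms, of r "\<lambda>_. 1" f] by simp
  also have "\<dots> = real r * sum f (ksub X r)"
    unfolding inner_ksub_def sum_distrib_left by (intro sum.cong refl) (auto simp: ksub_def)
  finally show ?thesis .
qed

lemma sum_lin_coeff:
  assumes "finite X" "X \<noteq> {}"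
  shows "sum (lin_coeff X r f) X = 0"
proof -
  have "(\<Sum>x\<in>X. deg X r f x - real r * sum f (ksub X r) / real (card X)) = 0"
    using assms by (simp add: sum_subtractf sum_deg)
  then show ?thesis by (simp add: lin_coeff_def flip: sum_divide_distrib)
qed

lemma real_binomial_absorb: "0 < k \<Longrightarrow> real k * real (n choose k) = real n * real ((n - 1) choose (k - 1))"
  using times_binomial_minus1_eq[of k n] by (metis of_nat_mult)

text \<open>By \<open>deg_sum\<close> the linear part has as degrees the deviations of the degrees
  of f from their mean, and the constant part has the mean degree. So all degrees of the residual
  vanish.\<close>

lemma orth_linear_residual:
  assumes "finite X" "2 * Suc (Suc s) \<le> card X"
  shows "orth_linear X (Suc (Suc s)) (lin_residual X (Suc (Suc s)) f)"
proof -
  let ?r = "Suc (Suc s)" and ?m = "card X"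
  let ?c = "lin_coeff X ?r f" and ?a = "sum f (ksub X ?r)" and ?N = "real (card X choose Suc (Suc s))"
  have "X \<noteq> {}" using assms by auto
  then have c0: "sum ?c X = 0" using assms by (simp add: sum_lin_coeff)
  have N: "?N > 0" and C2: "real ((?m - 2) choose (?r - 1)) > 0" using assms(2) by auto
  have m: "real ?m > 0" using assms(2) by simp
  have "sum (lin_residual X ?r f) (ksub X ?r) = ?a - real (card (ksub X ?r)) * (?a / ?N) - (\<Sum>S\<in>ksub X ?r. sum ?c S)"
    unfolding lin_residual_def sum_subtractf by simp
  also have "\<dots> = 0"
    unfolding sum_sum_ksub[OF assms(1)] card_ksub[OF assms(1)] c0 using N by simp
  finally have 1: "sum (lin_residual X ?r f) (ksub X ?r) = 0" .
  have "deg X ?r (lin_residual X ?r f) x = 0" if x: "x \<in> X" for x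
  proof -
    have "deg X ?r (lin_residual X ?r f) x = deg X ?r f x - deg X ?r (\<lambda>_. ?a / ?N) x - deg X ?r (sum ?c) x"
      unfolding lin_residual_def deg_def sum_subtractf by simp
    also have "\<dots> = deg X ?r f x - ?a * (real ((?m - 1) choose (?r - 1)) / ?N) - ?c x * real ((?m - 2) choose (?r - 1))"
      using deg_sum[OF assms(1) x c0, of s] deg_const[OF assms(1) x, of "Suc s" "?a / ?N"] by simp
    also have "real ((?m - 1) choose (?r - 1)) / ?N = real ?r / real ?m"
      using real_binomial_absorb[of ?r ?m] N m by (simp add: field_simps)
    finally show ?thesis using C2 by (simp add: lin_coeff_def)
  qed
  then have "inner_ksub X ?r (sum c) (lin_residual X ?r f) = 0" for c
    by (simp add: inner_ksub_sum[OF assms(1)])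
  with 1 show ?thesis by (simp add: orth_linear_def)
qed

text \<open>The inner product sees f only through its degrees, and their mean drops out because the
  coefficients of g sum to zero.\<close>

lemma inner_lin_coeff:
  assumes "finite X" "2 * Suc (Suc s) \<le> card X"
  shows "inner_ksub X (Suc (Suc s)) (sum (lin_coeff X (Suc (Suc s)) g)) f
    = real ((card X - 2) choose Suc s) * (\<Sum>x\<in>X. lin_coeff X (Suc (Suc s)) f x * lin_coeff X (Suc (Suc s)) g x)"
proof -
  let ?r = "Suc (Suc s)" and ?m = "card X"
  let ?c = "lin_coeff X ?r f" and ?k = "lin_coeff X ?r g" and ?a = "sum f (ksub X ?r)"
  have "X \<noteq> {}" using assms by auto
  then have c0: "sum ?k X = 0" using assms by (simp add: sum_lin_coeff)
  have C2: "real ((?m - 2) choose (?r - 1)) > 0" using assms(2) by auto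
  have "inner_ksub X ?r (sum ?k) f = (\<Sum>x\<in>X. ?k x * (real ((?m - 2) choose Suc s) * ?c x) + ?k x * (real ?r * ?a / real ?m))"
    unfolding inner_ksub_sum[OF assms(1)]
  proof (intro sum.cong refl)
    fix x
    have "deg X ?r f x = real ((?m - 2) choose Suc s) * ?c x + real ?r * ?a / real ?m"
      using C2 by (simp add: lin_coeff_def)
    then show "?k x * deg X ?r f x = ?k x * (real ((?m - 2) choose Suc s) * ?c x) + ?k x * (real ?r * ?a / real ?m)"
      by (simp only: distrib_left)
  qed
  also have "\<dots> = (\<Sum>x\<in>X. ?k x * (real ((?m - 2) choose Suc s) * ?c x))"
    by (simp only: sum.distrib sum_distrib_right[symmetric] c0 mult_zero_left add_0_right)
  finally show ?thesis by (simp add: sum_distrib_left algebra_simps)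
qed

lemma inner_lin_residual_expand:
  "inner_ksub X r (lin_residual X r f) h = inner_ksub X r f h
     - sum f (ksub X r) / real (card X choose r) * sum h (ksub X r) - inner_ksub X r (sum (lin_coeff X r f)) h"
  unfolding inner_ksub_def lin_residual_def left_diff_distrib sum_subtractf
  by (simp only: sum_distrib_left)

lemma inner_lin_residual:
  assumes "orth_linear X r h"
  shows "inner_ksub X r (lin_residual X r f) h = inner_ksub X r f h"
  using assms by (simp add: inner_lin_residual_expand orth_linear_def)

lemma inner_ksub_commute: "inner_ksub X r f g = inner_ksub X r g f"
  by (simp add: inner_ksub_def mult.commute)

text \<open>Pythagoras for the splitting into constant, linear and residual parts.\<close>

lemma lin_residual_norm:
  assumes "finite X" "2 * Suc (Suc s) \<le> card X"
  shows "inner_ksub X (Suc (Suc s)) (lin_residual X (Suc (Suc s)) f) (lin_residual X (Suc (Suc s)) f)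
    = inner_ksub X (Suc (Suc s)) f f - (sum f (ksub X (Suc (Suc s))))\<^sup>2 / real (card X choose Suc (Suc s))
      - real ((card X - 2) choose Suc s) * (\<Sum>x\<in>X. (lin_coeff X (Suc (Suc s)) f x)\<^sup>2)"
proof -
  let ?r = "Suc (Suc s)"
  let ?c = "lin_coeff X ?r f" and ?a = "sum f (ksub X ?r)"
  have "inner_ksub X ?r (lin_residual X ?r f) (lin_residual X ?r f) = inner_ksub X ?r (lin_residual X ?r f) f"
    using inner_lin_residual[OF orth_linear_residual[OF assms]] inner_ksub_commute by metis
  also have "\<dots> = inner_ksub X ?r f f - ?a / real (card X choose ?r) * ?a - inner_ksub X ?r (sum ?c) f"
    by (rule inner_lin_residual_expand)
  finally show ?thesis
    using inner_lin_coeff[OF assms, of f f] by (simp add: power2_eq_square)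
qed

text \<open>The operator preserves the three parts, so no mixed terms occur; on the first two it is
  multiplication by binom(m - r, r) and by - binom(m - r - 1, r - 1), where m = card X.\<close>

lemma inner_kneser_decomp:
  assumes "finite X" "2 * Suc (Suc s) \<le> card X"
  defines "r \<equiv> Suc (Suc s)"
  shows "inner_ksub X r f (kneser X r g)
    = real ((card X - r) choose r) * (sum f (ksub X r) * sum g (ksub X r) / real (card X choose r))
    - real ((card X - r - 1) choose (r - 1)) * (real ((card X - 2) choose (r - 1))
        * (\<Sum>x\<in>X. lin_coeff X r f x * lin_coeff X r g x))
    + inner_ksub X r (lin_residual X r f) (kneser X r (lin_residual X r g))"
proof -
  define q where "q = sum g (ksub X r) / real (card X choose r)"
  let ?c = "lin_coeff X r g"
  let ?l0 = "real ((card X - r) choose r)" and ?l1 = "real ((card X - r - 1) choose Suc s)"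
  have "X \<noteq> {}" using assms by auto
  then have c0: "sum ?c X = 0" using assms by (simp add: sum_lin_coeff)
  have K: "kneser X r g S = ?l0 * q - ?l1 * sum ?c S + kneser X r (lin_residual X r g) S" if "S \<in> ksub X r" for S
  proof -
    have "kneser X r g S = kneser X r (\<lambda>_. q) S + kneser X r (sum ?c) S + kneser X r (lin_residual X r g) S"
      unfolding kneser_def lin_residual_def q_def sum.distrib[symmetric] by simp
    then show ?thesis
      using kneser_const[OF assms(1) that, of q] kneser_sum[OF assms(1), of S "Suc s" ?c] that c0 by (simp add: r_def)
  qed
  have "inner_ksub X r f (kneser X r g)
    = (\<Sum>S\<in>ksub X r. f S * (?l0 * q - ?l1 * sum ?c S + kneser X r (lin_residual X r g) S))"
    unfolding inner_ksub_def by (intro sum.cong refl) (simp add: K)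
  also have "\<dots> = ?l0 * (sum f (ksub X r) * q) - ?l1 * inner_ksub X r (sum ?c) f + inner_ksub X r f (kneser X r (lin_residual X r g))"
    unfolding inner_ksub_def by (simp add: sum.distrib sum_subtractf sum_distrib_left sum_distrib_right algebra_simps)
  also have "inner_ksub X r f (kneser X r (lin_residual X r g))
    = inner_ksub X r (lin_residual X r f) (kneser X r (lin_residual X r g))"
    unfolding r_def
    using inner_lin_residual[OF orth_linear_kneser[OF assms(1) orth_linear_residual[OF assms(1,2)]]] by metis
  finally show ?thesis using inner_lin_coeff[OF assms(1,2), of g f] by (simp add: r_def q_def)
qed

text \<open>A Hoffman-type bound for two functions: when the Kneser form vanishes, the constant term
  must be balanced by the linear and residual terms. The hypotheses on
  \<open>inner_ksub X r f f\<close> and \<open>inner_ksub X r g g\<close> capture indicator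
  functions.\<close>

lemma kneser_independent_ineq:
  fixes f g :: "'a set \<Rightarrow> real"
  assumes "finite X" "2 * Suc (Suc s) \<le> card X" "real ((card X - s - 4) choose s) \<le> l"
  defines "r \<equiv> Suc (Suc s)"
  defines "\<alpha> \<equiv> sum f (ksub X r)" and "\<beta> \<equiv> sum g (ksub X r)"
  assumes "inner_ksub X r f (kneser X r g) = 0" "inner_ksub X r f f = \<alpha>" "inner_ksub X r g g = \<beta>"
  shows "(real ((card X - r) choose r) + l) * (\<alpha> * \<beta> / real (card X choose r))
    \<le> (real ((card X - r - 1) choose (r - 1)) - l) * (real ((card X - 2) choose (r - 1))
        * (\<Sum>x\<in>X. lin_coeff X r f x * lin_coeff X r g x)) + l * (\<alpha> + \<beta>) / 2"
proof -
  let ?C = "real ((card X - 2) choose (r - 1))" and ?N = "real (card X choose r)"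
  let ?c = "lin_coeff X r f" and ?k = "lin_coeff X r g"
  let ?F = "lin_residual X r f" and ?G = "lin_residual X r g"
  have l: "l \<ge> 0" using assms(3) by (meson of_nat_0_le_iff order_trans)
  have N: "?N > 0" using assms(2) by (simp add: r_def)
  have "- (l / 2) * (inner_ksub X r ?F ?F + inner_ksub X r ?G ?G) \<le> inner_ksub X r ?F (kneser X r ?G)"
    unfolding r_def using kneser_form_bound orth_linear_residual assms(1-3) by blast
  moreover have "inner_ksub X r ?F ?F = \<alpha> - \<alpha>\<^sup>2 / ?N - ?C * (\<Sum>x\<in>X. (?c x)\<^sup>2)"
    using lin_residual_norm[OF assms(1,2), of f] assms by simp
  moreover have "inner_ksub X r ?G ?G = \<beta> - \<beta>\<^sup>2 / ?N - ?C * (\<Sum>x\<in>X. (?k x)\<^sup>2)"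
    using lin_residual_norm[OF assms(1,2), of g] assms by simp
  \<comment> \<open>Here and for the sizes, squares are weakened to mixed products, so that the
    final inequality is bilinear in the two families.\<close>
  moreover have "2 * (?C * (\<Sum>x\<in>X. ?c x * ?k x)) \<le> ?C * (\<Sum>x\<in>X. (?c x)\<^sup>2) + ?C * (\<Sum>x\<in>X. (?k x)\<^sup>2)"
  proof -
    have "0 \<le> ?C * (\<Sum>x\<in>X. (?c x - ?k x)\<^sup>2)" by (simp add: sum_nonneg)
    also have "(\<Sum>x\<in>X. (?c x - ?k x)\<^sup>2) = (\<Sum>x\<in>X. (?c x)\<^sup>2) + (\<Sum>x\<in>X. (?k x)\<^sup>2) - 2 * (\<Sum>x\<in>X. ?c x * ?k x)"
      by (simp add: power2_diff sum.distrib sum_subtractf sum_distrib_left algebra_simps)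
    finally show ?thesis by (simp add: algebra_simps)
  qed
  moreover have "2 * (\<alpha> * \<beta> / ?N) \<le> \<alpha>\<^sup>2 / ?N + \<beta>\<^sup>2 / ?N"
  proof -
    have "0 \<le> (\<alpha> - \<beta>)\<^sup>2 / ?N" by simp
    then show ?thesis by (simp add: power2_diff diff_divide_distrib add_divide_distrib)
  qed
  ultimately have bound: "- (l / 2) * (inner_ksub X r ?F ?F + inner_ksub X r ?G ?G) \<le> inner_ksub X r ?F (kneser X r ?G)"
    and "inner_ksub X r ?F ?F + inner_ksub X r ?G ?G \<le> \<alpha> + \<beta> - 2 * (\<alpha> * \<beta> / ?N) - 2 * (?C * (\<Sum>x\<in>X. ?c x * ?k x))"
    by linarith+
  from mult_left_mono[OF this(2), of "l / 2"] l
  have "- (l / 2) * (\<alpha> + \<beta> - 2 * (\<alpha> * \<beta> / ?N) - 2 * (?C * (\<Sum>x\<in>X. ?c x * ?k x)))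
    \<le> inner_ksub X r ?F (kneser X r ?G)"
    using bound by linarith
  moreover have "0 = real ((card X - r) choose r) * (\<alpha> * \<beta> / ?N)
    - real ((card X - r - 1) choose (r - 1)) * (?C * (\<Sum>x\<in>X. ?c x * ?k x)) + inner_ksub X r ?F (kneser X r ?G)"
    using inner_kneser_decomp[OF assms(1,2), of f g] assms(7)
    unfolding r_def[symmetric] \<alpha>_def[symmetric] \<beta>_def[symmetric] by simp
  ultimately show ?thesis
    unfolding distrib_right left_diff_distrib by (simp add: field_simps del: times_divide_eq_right)
qed

subsection \<open>Infeasibility of large degrees\<close>

text \<open>The form is affine in A and in B, hence an interpolation of its values at the corners of
  [0, w] x [0, w], which the hypotheses make nonnegative.\<close>

lemma symmetric_bilinear_nonneg:
  fixes A :: real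
  assumes "0 \<le> A" "A \<le> w" "0 \<le> B" "B \<le> w" "0 \<le> c\<^sub>0" "0 \<le> c\<^sub>1" "0 \<le> c\<^sub>0 + 2 * c\<^sub>1 * w + c\<^sub>2 * w\<^sup>2"
  shows "0 \<le> c\<^sub>0 + c\<^sub>1 * (A + B) + c\<^sub>2 * (A * B)"
proof (cases "w = 0")
  case True
  then show ?thesis using assms by simp
next
  case False
  then have w: "w\<^sup>2 > 0" by simp
  have "0 \<le> (w - A) * (w - B) * c\<^sub>0" "0 \<le> ((w - A) * B + A * (w - B)) * (c\<^sub>0 + c\<^sub>1 * w)"
    using assms(1-6) by simp_all
  moreover have "0 \<le> A * B * (c\<^sub>0 + 2 * c\<^sub>1 * w + c\<^sub>2 * w\<^sup>2)"
    using assms(1,3,7) by (intro mult_nonneg_nonneg)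
  ultimately have "0 \<le> (w - A) * (w - B) * c\<^sub>0 + ((w - A) * B + A * (w - B)) * (c\<^sub>0 + c\<^sub>1 * w)
      + A * B * (c\<^sub>0 + 2 * c\<^sub>1 * w + c\<^sub>2 * w\<^sup>2)"
    by linarith
  also have "\<dots> = w\<^sup>2 * (c\<^sub>0 + c\<^sub>1 * (A + B) + c\<^sub>2 * (A * B))"
    by (simp add: power2_eq_square algebra_simps)
  finally show ?thesis using w by (simp add: zero_le_mult_iff)
qed

text \<open>If u is the density of the family, A stands for (m - 1) u - (r - 1), which is 0 when all degrees
are the bound and (m - r) / m for a star; likewise B. Both sides agree for two stars.\<close>
lemma star_extremal_ineq:
  fixes m r A B :: real
  assumes "2 \<le> r" "2 * r + 1 \<le> m" and "0 \<le> A" "A \<le> (m - r) / m" "0 \<le> B" "B \<le> (m - r) / m"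
  defines "E \<equiv> m * (m - 1) - 2 * r * (m - r)"
  shows "(m - 2 * r) * r\<^sup>2 * (m - 1)\<^sup>2 / (m - r) * (A * B) + r * (r - 1) * (m - 1) * (A + B + 2 * (r - 1)) / 2
    \<le> E * ((A + r - 1) * (B + r - 1))"
proof -
  define \<rho> where "\<rho> = (m - 2 * r) * r\<^sup>2 * (m - 1)\<^sup>2 / (m - r)"
  define \<sigma> where "\<sigma> = r * (r - 1) * (m - 1)"
  define w where "w = (m - r) / m"
  have m: "m > 0" "m - r > 0" using assms by auto
  \<comment> \<open>This factorization is where 2 r + 1 \<le> m enters.\<close>
  have "E - r * (m - 1) = (m - 2 * r - 1) * (m - r)" by (simp add: E_def algebra_simps)
  moreover have "0 \<le> (m - 2 * r - 1) * (m - r)" using assms m by (intro mult_nonneg_nonneg) auto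
  ultimately have E: "r * (m - 1) \<le> E" by simp
  have c0: "0 \<le> E * (r - 1)\<^sup>2 - \<sigma> * (r - 1)"
  proof -
    have "0 \<le> (E - r * (m - 1)) * (r - 1)\<^sup>2" using E by simp
    then show ?thesis by (simp add: \<sigma>_def power2_eq_square algebra_simps)
  qed
  have c1: "0 \<le> E * (r - 1) - \<sigma> / 2"
  proof -
    have "\<sigma> = r * (m - 1) * (r - 1)" by (simp add: \<sigma>_def)
    also have "\<dots> \<le> E * (r - 1)" using E assms(1) by (intro mult_right_mono) auto
    finally have "\<sigma> \<le> E * (r - 1)" .
    moreover have "\<sigma> \<ge> 0" using assms(1,2) by (simp add: \<sigma>_def)
    ultimately show ?thesis by linarith
  qed
  have ww: "w + r - 1 = r * (m - 1) / m" using m by (simp add: w_def field_simps)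
  \<comment> \<open>The corner A = B = w corresponds to two stars; the expression vanishes there
    identically.\<close>
  have "(E * (r - 1)\<^sup>2 - \<sigma> * (r - 1)) + 2 * (E * (r - 1) - \<sigma> / 2) * w + (E - \<rho>) * w\<^sup>2
      = E * (w + r - 1)\<^sup>2 - \<rho> * w\<^sup>2 - \<sigma> * (w + r - 1)"
    by (simp add: power2_eq_square algebra_simps)
  also have "\<rho> * w\<^sup>2 = (r * (m - 1) / m)\<^sup>2 * ((m - 2 * r) * (m - r))"
    using m by (simp add: \<rho>_def w_def power2_eq_square)
  also have "\<sigma> * (w + r - 1) = (r * (m - 1) / m)\<^sup>2 * ((r - 1) * m)"
    unfolding ww using m by (simp add: \<sigma>_def power2_eq_square)
  also have "E * (w + r - 1)\<^sup>2 - (r * (m - 1) / m)\<^sup>2 * ((m - 2 * r) * (m - r)) - (r * (m - 1) / m)\<^sup>2 * ((r - 1) * m)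
      = (r * (m - 1) / m)\<^sup>2 * (E - (m - 2 * r) * (m - r) - (r - 1) * m)"
    unfolding ww by (simp only: algebra_simps)
  also have "E - (m - 2 * r) * (m - r) - (r - 1) * m = 0"
    by (simp add: E_def algebra_simps)
  finally have "0 \<le> (E * (r - 1)\<^sup>2 - \<sigma> * (r - 1)) + 2 * (E * (r - 1) - \<sigma> / 2) * w + (E - \<rho>) * w\<^sup>2"
    by simp
  from symmetric_bilinear_nonneg[OF assms(3) _ assms(5) _ c0 c1 this] assms(4,6)
  have "0 \<le> (E * (r - 1)\<^sup>2 - \<sigma> * (r - 1)) + (E * (r - 1) - \<sigma> / 2) * (A + B) + (E - \<rho>) * (A * B)"
    by (simp add: w_def)
  then show ?thesis
    unfolding \<rho>_def[symmetric] \<sigma>_def[symmetric]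
    by (simp add: power2_eq_square algebra_simps add_divide_distrib diff_divide_distrib)
qed

text \<open>With the first term frozen at A = w, the right side minus the left is affine in A with
  positive slope, so the case A = w of \<open>star_extremal_ineq\<close> becomes strict beyond
  w.\<close>

lemma star_extremal_ineq_strict:
  fixes m r A B :: real
  assumes "2 \<le> r" "2 * r + 1 \<le> m" and "(m - r) / m < A" "0 \<le> B" "B \<le> (m - r) / m"
  defines "E \<equiv> m * (m - 1) - 2 * r * (m - r)"
  shows "(m - 2 * r) * r\<^sup>2 * (m - 1)\<^sup>2 / (m - r) * ((m - r) / m * B) + r * (r - 1) * (m - 1) * (A + B + 2 * (r - 1)) / 2
    < E * ((A + r - 1) * (B + r - 1))"
proof -
  define w where "w = (m - r) / m"
  define \<sigma> where "\<sigma> = r * (r - 1) * (m - 1)"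
  have m: "m > 0" "m - r > 0" using assms by auto
  then have w: "w > 0" by (simp add: w_def)
  have \<sigma>: "\<sigma> > 0" using assms by (simp add: \<sigma>_def)
  have "E - r * (m - 1) = (m - 2 * r - 1) * (m - r)" by (simp add: E_def algebra_simps)
  moreover have "0 \<le> (m - 2 * r - 1) * (m - r)" using assms m by (intro mult_nonneg_nonneg) auto
  ultimately have E: "r * (m - 1) \<le> E" by simp
  moreover have "r * (m - 1) > 0" using assms by simp
  ultimately have "E > 0" by linarith
  have "\<sigma> = r * (m - 1) * (r - 1)" by (simp add: \<sigma>_def)
  also have "\<dots> \<le> E * (B + r - 1)" using E assms \<open>E > 0\<close> by (intro mult_mono) auto
  finally have gap: "0 < (A - w) * (E * (B + r - 1) - \<sigma> / 2)"
    using assms(3) \<sigma> by (intro mult_pos_pos) (auto simp: w_def)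
  define R where "R = (m - 2 * r) * r\<^sup>2 * (m - 1)\<^sup>2 / (m - r)"
  have "R * (w * B) + \<sigma> * (w + B + 2 * (r - 1)) / 2 \<le> E * ((w + r - 1) * (B + r - 1))"
    using star_extremal_ineq[of r m w B] assms w unfolding R_def \<sigma>_def w_def E_def by simp
  with gap have "R * (w * B) + \<sigma> * (A + B + 2 * (r - 1)) / 2 < E * ((A + r - 1) * (B + r - 1))"
    by (simp add: algebra_simps add_divide_distrib diff_divide_distrib)
  then show ?thesis unfolding R_def \<sigma>_def w_def .
qed

text \<open>Here u, v are densities and d, e normalized degrees, with \<delta> the value at a
  non-central vertex of a star. The excesses over \<delta> are positive, which bounds their
  covariance from above; the bound depends on how A and B compare with the star value w.\<close>

lemma degree_system_infeasible:
  fixes m r u v :: real and d e :: "'a \<Rightarrow> real"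
  defines "\<delta> \<equiv> r * (r - 1) / (m * (m - 1))"
  assumes X: "finite X" "m = real (card X)" and r: "2 \<le> r" "2 * r + 1 \<le> m"
    and sums: "sum d X = r * u" "sum e X = r * v"
    and low: "\<And>x. x \<in> X \<Longrightarrow> \<delta> < d x" "\<And>x. x \<in> X \<Longrightarrow> \<delta> < e x"
    and up: "\<And>x. x \<in> X \<Longrightarrow> d x \<le> r / m" and "v \<le> u"
    and ineq1: "m * (u * v) \<le> r * (u + v) / 2"
    and ineq2: "(m * (m - 1) - 2 * r * (m - r)) * (u * v)
      \<le> (m - 2 * r) * (m * (m - 1) / (m - r)) * (\<Sum>x\<in>X. (d x - r * u / m) * (e x - r * v / m)) + r * (r - 1) * (u + v) / 2"
  shows False
proof -
  define E where "E = m * (m - 1) - 2 * r * (m - r)"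
  define w where "w = (m - r) / m"
  define A where "A = (m - 1) * u - (r - 1)"
  define B where "B = (m - 1) * v - (r - 1)"
  define V where "V = (\<Sum>x\<in>X. (d x - r * u / m) * (e x - r * v / m))"
  define p where "p x = d x - \<delta>" for x
  define q where "q x = e x - \<delta>" for x
  have m: "m > 0" "m - 1 > 0" "m - r > 0" "m - 2 * r > 0" using r by auto
  have "X \<noteq> {}" using X m by auto
  have pos: "p x > 0" "q x > 0" if "x \<in> X" for x using low[OF that] by (auto simp: p_def q_def)
  have m\<delta>: "m * \<delta> = r * (r - 1) / (m - 1)" using m by (simp add: \<delta>_def)
  have P: "sum p X = r * A / (m - 1)"
    using m X sums m\<delta> by (simp add: p_def sum_subtractf A_def field_simps)
  have Q: "sum q X = r * B / (m - 1)"
    using m X sums m\<delta> by (simp add: q_def sum_subtractf B_def field_simps)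
  have Ppos: "sum p X > 0" and Qpos: "sum q X > 0"
    using X(1) \<open>X \<noteq> {}\<close> pos by (auto intro!: sum_pos)
  then have AB: "A > 0" "B > 0" using P Q m r by (auto simp: zero_less_mult_iff zero_less_divide_iff)
  have V: "V = (\<Sum>x\<in>X. p x * q x) - sum p X * sum q X / m"
  proof -
    have 1: "d x - r * u / m = p x - sum p X / m" "e x - r * v / m = q x - sum q X / m" for x
    proof -
      have "sum p X = r * u - m * \<delta>" "sum q X = r * v - m * \<delta>"
        using sums X(2) by (simp_all add: p_def q_def sum_subtractf)
      then show "d x - r * u / m = p x - sum p X / m" "e x - r * v / m = q x - sum q X / m"
        using m by (simp_all add: p_def q_def diff_divide_distrib)
    qed
    have "V = (\<Sum>x\<in>X. p x * q x - p x * (sum q X / m) - sum p X / m * q x + sum p X * sum q X / m\<^sup>2)"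
      unfolding V_def 1 by (simp add: algebra_simps power2_eq_square)
    also have "\<dots> = (\<Sum>x\<in>X. p x * q x) - sum p X * (sum q X / m) - sum p X / m * sum q X + m * (sum p X * sum q X / m\<^sup>2)"
      unfolding sum.distrib sum_subtractf sum_distrib_left[symmetric] sum_distrib_right[symmetric] X(2) by simp
    finally show ?thesis using m by (simp add: power2_eq_square)
  qed
  have ineq2': "E * ((A + r - 1) * (B + r - 1))
    \<le> (m - 2 * r) * (m * (m - 1) ^ 3 / (m - r)) * V + r * (r - 1) * (m - 1) * (A + B + 2 * (r - 1)) / 2"
  proof -
    have "(m - 1)\<^sup>2 * (E * (u * v))
      \<le> (m - 1)\<^sup>2 * ((m - 2 * r) * (m * (m - 1) / (m - r)) * V + r * (r - 1) * (u + v) / 2)"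
      using ineq2 by (intro mult_left_mono) (auto simp: E_def V_def)
    also have "\<dots> = (m - 2 * r) * (m * (m - 1) ^ 3 / (m - r)) * V + r * (r - 1) * (m - 1) * ((m - 1) * u + (m - 1) * v) / 2"
      by (simp add: power2_eq_square power3_eq_cube distrib_left add_divide_distrib mult_ac)
    finally show ?thesis
      by (simp add: A_def B_def power2_eq_square mult.left_commute mult.assoc)
  qed
  \<comment> \<open>Converts a bound on V by totals of p and q into the leading term of
    \<open>star_extremal_ineq\<close>.\<close>
  have coef: "(m - 2 * r) * (m * (m - 1) ^ 3 / (m - r)) * (r * x / (m - 1) * (r * y / (m - 1)) * (1 - 1 / m))
      = (m - 2 * r) * r\<^sup>2 * (m - 1)\<^sup>2 / (m - r) * (x * y)" for x y
  proof -
    have "c * (m * n ^ 3 / h) * (r * x / n * (r * y / n) * (n / m)) = c * r\<^sup>2 * n\<^sup>2 / h * (x * y)"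
      if "n \<noteq> 0" "h \<noteq> 0" for c n h :: real
      using that m by (simp add: field_simps power2_eq_square power3_eq_cube)
    moreover have "1 - 1 / m = (m - 1) / m" using m by (simp add: diff_divide_distrib)
    ultimately show ?thesis using m by simp
  qed
  have cpos: "(m - 2 * r) * (m * (m - 1) ^ 3 / (m - r)) > 0" using m by simp
  consider "A \<le> w" "B \<le> w" | "w < A" "B \<le> w" | "w < A" "w < B"
  proof -
    have "B \<le> A" using \<open>v \<le> u\<close> m by (simp add: A_def B_def)
    then show ?thesis using that by linarith
  qed
  then show False
  proof cases
    case 1
    \<comment> \<open>Positivity of the other excesses gives this, so the sum of the products is
      less than the product of the sums.\<close>
    have pP: "p x < sum p X" if x: "x \<in> X" for x
    proof -
      have "card X > 1" using X(2) r by linarith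
      then have "X - {x} \<noteq> {}" using x X(1) by (metis card_0_eq card_Diff_singleton finite_Diff less_numeral_extra(3) zero_less_diff)
      then have "sum p (X - {x}) > 0" using X(1) pos by (intro sum_pos) auto
      then show ?thesis using x X(1) by (simp add: sum.remove)
    qed
    have "(\<Sum>x\<in>X. p x * q x) < (\<Sum>x\<in>X. sum p X * q x)"
      using X(1) \<open>X \<noteq> {}\<close> pP pos by (intro sum_strict_mono mult_strict_right_mono) auto
    also have "\<dots> = sum p X * sum q X" by (simp add: sum_distrib_left)
    finally have "V < sum p X * sum q X * (1 - 1 / m)" unfolding V by (simp add: algebra_simps)
    then have "(m - 2 * r) * (m * (m - 1) ^ 3 / (m - r)) * V < (m - 2 * r) * r\<^sup>2 * (m - 1)\<^sup>2 / (m - r) * (A * B)"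
      using mult_strict_left_mono[OF _ cpos] unfolding coef[symmetric] P Q by blast
    then show False
      using ineq2' star_extremal_ineq[of r m A B] r AB 1 unfolding E_def w_def by linarith
  next
    case 2
    \<comment> \<open>For A above w the total of p is too weak a bound; the cap r / m on degrees
      replaces it and freezes A at w.\<close>
    have "p x \<le> r * w / (m - 1)" if "x \<in> X" for x
    proof -
      have "r / m - \<delta> = r * w / (m - 1)" using m by (simp add: \<delta>_def w_def field_simps)
      then show ?thesis using up[OF that] by (simp add: p_def)
    qed
    then have "(\<Sum>x\<in>X. p x * q x) \<le> (\<Sum>x\<in>X. r * w / (m - 1) * q x)"
      using pos by (intro sum_mono mult_right_mono) (auto simp: less_imp_le)
    also have "\<dots> = r * w / (m - 1) * sum q X" by (simp add: sum_distrib_left)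
    finally have "V \<le> r * w / (m - 1) * sum q X - sum p X * sum q X / m" unfolding V by simp
    also have "\<dots> \<le> r * w / (m - 1) * sum q X - (r * w / (m - 1)) * sum q X / m"
      using 2 Qpos m r unfolding P by (intro diff_left_mono divide_right_mono mult_right_mono mult_left_mono) auto
    finally have "V \<le> r * w / (m - 1) * sum q X * (1 - 1 / m)"
      by (simp only: right_diff_distrib mult_1_right times_divide_eq_right)
    then have "(m - 2 * r) * (m * (m - 1) ^ 3 / (m - r)) * V \<le> (m - 2 * r) * r\<^sup>2 * (m - 1)\<^sup>2 / (m - r) * (w * B)"
      using mult_left_mono[OF _ less_imp_le[OF cpos]] unfolding coef[symmetric] Q by blast
    then show False
      using ineq2' star_extremal_ineq_strict[of r m A B] r AB 2 unfolding E_def w_def by linarith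
  next
    case 3
    \<comment> \<open>Both densities now exceed the star density r / m, contradicting
      \<open>ineq1\<close>.\<close>
    have ww: "w + (r - 1) = (m - 1) * (r / m)" using m by (simp add: w_def field_simps)
    have "(m - 1) * (r / m) < (m - 1) * u" "(m - 1) * (r / m) < (m - 1) * v"
      using 3 ww by (auto simp: A_def B_def)
    then have uv: "r / m < u" "r / m < v" using mult_less_cancel_left_pos[OF m(2)] by blast+
    then have "r < m * u" "r < m * v" using m by (simp_all add: field_simps)
    moreover have "u > 0" "v > 0" using uv m r by (meson divide_pos_pos less_trans zero_less_numeral less_le_trans)+
    ultimately have "r * v < m * u * v" "r * u < m * v * u" by simp_all
    then show False using ineq1 by (simp add: algebra_simps)
  qed
qed

subsection \<open>Degrees in cross-intersecting families\<close>

lemma cross_intersecting_degrees_le: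
  fixes X :: "'a set"
  assumes X: "finite X" and sub: "\<A> \<subseteq> ksub X r" "\<B> \<subseteq> ksub X r" and r: "2 \<le> r" "2 * r + 1 \<le> card X"
    and cross: "\<And>S T. S \<in> \<A> \<Longrightarrow> T \<in> \<B> \<Longrightarrow> S \<inter> T \<noteq> {}"
    and deg: "\<And>x. x \<in> X \<Longrightarrow> (card X - 2) choose (r - 2) < card {S \<in> \<A>. x \<in> S}"
      "\<And>x. x \<in> X \<Longrightarrow> (card X - 2) choose (r - 2) < card {S \<in> \<B>. x \<in> S}"
    and le: "card \<B> \<le> card \<A>"
  shows False
proof -
  obtain s where s: "r = Suc (Suc s)" using r(1) by (metis add_2_eq_Suc le_Suc_ex)
  define m where "m = real (card X)"
  define k where "k = real r"
  define N where "N = real (card X choose r)"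
  define C\<^sub>1 where "C\<^sub>1 = real ((card X - 1) choose (r - 1))"
  define C\<^sub>2 where "C\<^sub>2 = real ((card X - 2) choose (r - 1))"
  define D where "D = real ((card X - 2) choose (r - 2))"
  define l\<^sub>0 where "l\<^sub>0 = real ((card X - r) choose r)"
  define l\<^sub>1 where "l\<^sub>1 = real ((card X - r - 1) choose (r - 1))"
  define l\<^sub>2 where "l\<^sub>2 = real ((card X - r - 2) choose (r - 2))"
  define f where "f S = (of_bool (S \<in> \<A>) :: real)" for S
  define g where "g S = (of_bool (S \<in> \<B>) :: real)" for S
  define u where "u = real (card \<A>) / N"
  define v where "v = real (card \<B>) / N"
  define d where "d x = deg X r f x / N" for x
  define e where "e x = deg X r g x / N" for x
  define V where "V = (\<Sum>x\<in>X. (d x - k * u / m) * (e x - k * v / m))"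
  have k: "k \<ge> 2" and mk: "m \<ge> 2 * k + 1" using r by (simp_all add: k_def m_def)
  have m: "m > 0" "m - 1 > 0" "m - k > 0" "m - k - 1 > 0" "m - 2 * k > 0" "k - 1 > 0" "k > 0"
    using k mk by auto
  have N: "N > 0" using r by (simp add: N_def)
  have l1: "k * l\<^sub>0 = (m - k) * l\<^sub>1"
    using real_binomial_absorb[of r "card X - r"] r by (simp add: l\<^sub>0_def l\<^sub>1_def k_def m_def of_nat_diff)
  have l2: "(k - 1) * l\<^sub>1 = (m - k - 1) * l\<^sub>2"
    using real_binomial_absorb[of "r - 1" "card X - r - 1"] r
    by (simp add: l\<^sub>1_def l\<^sub>2_def k_def m_def of_nat_diff numeral_2_eq_2)
  have l2pos: "l\<^sub>2 > 0" using r by (simp add: l\<^sub>2_def)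
  then have l1pos: "l\<^sub>1 > 0" using l2 m by (metis mult_pos_pos zero_less_mult_pos)
  have C1: "k * N = m * C\<^sub>1"
    using real_binomial_absorb[of r "card X"] r by (simp add: N_def C\<^sub>1_def k_def m_def)
  have D: "(k - 1) * C\<^sub>1 = (m - 1) * D"
    using real_binomial_absorb[of "r - 1" "card X - 1"] r
    by (simp add: C\<^sub>1_def D_def k_def m_def of_nat_diff numeral_2_eq_2)
  have "C\<^sub>1 = C\<^sub>2 + D"
  proof -
    have "card X - 1 = Suc (card X - 2)" "r - 1 = Suc (r - 2)" using r by auto
    then show ?thesis by (simp add: C\<^sub>1_def C\<^sub>2_def D_def binomial_Suc_Suc)
  qed
  have C1': "C\<^sub>1 = N * (k / m)" using C1 m by (simp add: field_simps)
  have D': "D = N * (k * (k - 1) / (m * (m - 1)))" using D m unfolding C1' by (simp add: field_simps)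
  have C2': "C\<^sub>2 = N * (k * (m - k) / (m * (m - 1)))"
  proof -
    have "C\<^sub>2 = N * (k / m - k * (k - 1) / (m * (m - 1)))"
      using \<open>C\<^sub>1 = C\<^sub>2 + D\<close> unfolding C1' D' by (simp add: right_diff_distrib)
    also have "k / m - k * (k - 1) / (m * (m - 1)) = k * (m - k) / (m * (m - 1))"
      using m by (simp add: field_simps)
    finally show ?thesis .
  qed
  have sum_f: "sum f (ksub X r) = real (card \<A>)" and sum_g: "sum g (ksub X r) = real (card \<B>)"
    using X sub by (simp_all add: f_def g_def Int_absorb1)
  have deg_f: "deg X r f x = real (card {S \<in> \<A>. x \<in> S})" and deg_g: "deg X r g x = real (card {S \<in> \<B>. x \<in> S})" for x
  proof -
    have "{S \<in> ksub X r. x \<in> S} \<inter> \<A> = {S \<in> \<A>. x \<in> S}" "{S \<in> ksub X r. x \<in> S} \<inter> \<B> = {S \<in> \<B>. x \<in> S}"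
      using sub by auto
    then show "deg X r f x = real (card {S \<in> \<A>. x \<in> S})" "deg X r g x = real (card {S \<in> \<B>. x \<in> S})"
      using X by (simp_all add: deg_def f_def g_def)
  qed
  \<comment> \<open>Cross-intersection means that no edge of the Kneser graph joins the two
    families.\<close>
  have indep: "inner_ksub X r f (kneser X r g) = 0"
    unfolding inner_ksub_def kneser_def sum_distrib_left
    using cross by (intro sum.neutral ballI) (auto simp: f_def g_def ksub_def)
  have norms: "inner_ksub X r f f = sum f (ksub X r)" "inner_ksub X r g g = sum g (ksub X r)"
    by (simp_all add: inner_ksub_def f_def g_def flip: of_bool_conj)
  have coeffs: "lin_coeff X r f x = N / C\<^sub>2 * (d x - k * u / m)" "lin_coeff X r g x = N / C\<^sub>2 * (e x - k * v / m)" for x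
  proof -
    have *: "(N * y - k * (N * z) / m) / C\<^sub>2 = N / C\<^sub>2 * (y - k * z / m)" for y z
      by (simp add: right_diff_distrib diff_divide_distrib mult.left_commute)
    have "deg X r f x = N * d x" "deg X r g x = N * e x" "real (card \<A>) = N * u" "real (card \<B>) = N * v"
      using N by (simp_all add: d_def e_def u_def v_def)
    then show "lin_coeff X r f x = N / C\<^sub>2 * (d x - k * u / m)" "lin_coeff X r g x = N / C\<^sub>2 * (e x - k * v / m)"
      unfolding *[symmetric] by (simp_all add: lin_coeff_def sum_f sum_g k_def m_def C\<^sub>2_def)
  qed
  have cov: "C\<^sub>2 * (\<Sum>x\<in>X. lin_coeff X r f x * lin_coeff X r g x) = N * (N / C\<^sub>2) * V"
  proof -
    have "C\<^sub>2 > 0" using C2' m N by simp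
    have "(\<Sum>x\<in>X. lin_coeff X r f x * lin_coeff X r g x) = (N / C\<^sub>2) * (N / C\<^sub>2) * V"
      unfolding coeffs V_def sum_distrib_left by (intro sum.cong refl) (simp only: mult_ac)
    then show ?thesis using \<open>C\<^sub>2 > 0\<close> by simp
  qed
  have ineq: "(l\<^sub>0 + l) * (u * v) \<le> (l\<^sub>1 - l) * (N / C\<^sub>2 * V) + l * (u + v) / 2" if "l\<^sub>2 \<le> l" for l
  proof -
    have "card X - s - 4 = card X - r - 2" "s = r - 2" using s by auto
    then have "real ((card X - s - 4) choose s) \<le> l" using that by (simp add: l\<^sub>2_def)
    from kneser_independent_ineq[OF X _ this, of f g, folded s, OF _ indep norms]
    have "(l\<^sub>0 + l) * (real (card \<A>) * real (card \<B>) / N)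
      \<le> (l\<^sub>1 - l) * (N * (N / C\<^sub>2) * V) + l * (real (card \<A>) + real (card \<B>)) / 2"
      using r unfolding sum_f sum_g cov[symmetric] by (simp add: l\<^sub>0_def l\<^sub>1_def C\<^sub>2_def N_def)
    also have "real (card \<A>) = N * u" using N by (simp add: u_def)
    also have "real (card \<B>) = N * v" using N by (simp add: v_def)
    finally have "N * ((l\<^sub>0 + l) * (u * v)) \<le> N * ((l\<^sub>1 - l) * (N / C\<^sub>2 * V) + l * (u + v) / 2)"
      using N by (simp add: algebra_simps add_divide_distrib)
    then show ?thesis using N by simp
  qed
  have NC: "N / C\<^sub>2 = m * (m - 1) / (k * (m - k))" using N m by (simp add: C2')
  have l0': "l\<^sub>0 = (m - k) / k * l\<^sub>1" using l1 m by (simp add: field_simps)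
  have l1': "l\<^sub>1 = (m - k - 1) / (k - 1) * l\<^sub>2" using l2 m by (simp add: field_simps)
  have l21: "l\<^sub>2 \<le> l\<^sub>1"
  proof -
    have "(k - 1) * l\<^sub>2 \<le> (m - k - 1) * l\<^sub>2" using l2pos m by (intro mult_right_mono) auto
    then show ?thesis using l2 m by (metis mult_le_cancel_left_pos)
  qed
  show False
  proof (rule degree_system_infeasible[OF X, of m k d u e v])
    show "m = real (card X)" by (simp add: m_def)
    show "sum d X = k * u" "sum e X = k * v"
      using sum_deg[OF X, of r f] sum_deg[OF X, of r g]
      by (simp_all add: d_def e_def u_def v_def k_def sum_f sum_g flip: sum_divide_distrib)
    show "v \<le> u" using le N by (simp add: u_def v_def divide_right_mono)
    fix x assume x: "x \<in> X"
    have "D < deg X r f x" "D < deg X r g x" using deg[OF x] by (simp_all add: D_def deg_f deg_g)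
    then show "k * (k - 1) / (m * (m - 1)) < d x" "k * (k - 1) / (m * (m - 1)) < e x"
      using N by (simp_all add: D' d_def e_def pos_less_divide_eq mult.commute)
    have "deg X r f x \<le> deg X r (\<lambda>_. 1) x"
      unfolding deg_def by (intro sum_mono) (simp add: f_def)
    also have "\<dots> = N * (k / m)"
      using deg_const[OF X x, of "r - 1" 1] s unfolding C1'[symmetric] by (simp add: C\<^sub>1_def)
    finally show "d x \<le> k / m" using N by (simp add: d_def pos_divide_le_eq mult.commute)
  next
    \<comment> \<open>The choice l = \<open>l\<^sub>1\<close> removes the covariance term and leaves
      a bound on densities alone.\<close>
    have "l\<^sub>0 + l\<^sub>1 = l\<^sub>1 * (m / k)" using m unfolding l0' by (simp add: field_simps)
    then have "l\<^sub>1 * (m / k * (u * v)) \<le> l\<^sub>1 * ((u + v) / 2)"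
      using ineq[OF l21] by simp
    then have "m / k * (u * v) \<le> (u + v) / 2" using mult_le_cancel_left_pos[OF l1pos] by blast
    then have "k * (m / k * (u * v)) \<le> k * ((u + v) / 2)" using m by (intro mult_left_mono) auto
    then show "m * (u * v) \<le> k * (u + v) / 2" using m by simp
  next
    \<comment> \<open>The sharp choice \<open>l\<^sub>2\<close> gives the second inequality; all
      three binomials are polynomial multiples of this l, which then cancels.\<close>
    define l where "l = l\<^sub>2 / (k - 1) / k"
    have l: "l > 0" using l2pos m by (simp add: l_def)
    have e2: "l\<^sub>2 = l * (k * (k - 1))" using m by (simp add: l_def)
    have e1: "l\<^sub>1 = l * (k * (m - k - 1))" unfolding l1' e2 using m by simp
    have e0: "l\<^sub>0 = l * ((m - k) * (m - k - 1))" unfolding l0' e1 using m by simp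
    have "l * (((m - k) * (m - k - 1) + k * (k - 1)) * (u * v))
      \<le> l * ((k * (m - k - 1) - k * (k - 1)) * (N / C\<^sub>2 * V) + k * (k - 1) * (u + v) / 2)"
      using ineq[OF order_refl] unfolding e0 e1 e2
      by (simp add: algebra_simps add_divide_distrib diff_divide_distrib)
    then have "((m - k) * (m - k - 1) + k * (k - 1)) * (u * v)
      \<le> (k * (m - k - 1) - k * (k - 1)) * (N / C\<^sub>2 * V) + k * (k - 1) * (u + v) / 2"
      using l by simp
    also have "(k * (m - k - 1) - k * (k - 1)) * (N / C\<^sub>2 * V) = (m - 2 * k) * (m * (m - 1) / (m - k)) * V"
    proof -
      have "(k * (m - k - 1) - k * (k - 1)) = k * (m - 2 * k)" by (simp add: algebra_simps)
      then show ?thesis unfolding NC using m by simp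
    qed
    also have "(m - k) * (m - k - 1) + k * (k - 1) = m * (m - 1) - 2 * k * (m - k)"
      by (simp add: algebra_simps)
    finally show "(m * (m - 1) - 2 * k * (m - k)) * (u * v) \<le> (m - 2 * k) * (m * (m - 1) / (m - k))
      * (\<Sum>x\<in>X. (d x - k * u / m) * (e x - k * v / m)) + k * (k - 1) * (u + v) / 2"
      by (simp add: V_def)
  qed (use k mk in auto)
qed

lemma cross_intersecting_min_degree:
  assumes "finite X" "\<A> \<subseteq> ksub X r" "\<B> \<subseteq> ksub X r" "2 \<le> r" "2 * r + 1 \<le> card X"
    and "\<And>S T. S \<in> \<A> \<Longrightarrow> T \<in> \<B> \<Longrightarrow> S \<inter> T \<noteq> {}"
  shows "\<exists>x\<in>X. card {S \<in> \<A>. x \<in> S} \<le> (card X - 2) choose (r - 2)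
    \<or> card {S \<in> \<B>. x \<in> S} \<le> (card X - 2) choose (r - 2)"
proof (rule ccontr)
  assume "\<not> ?thesis"
  then have deg: "\<And>x. x \<in> X \<Longrightarrow> (card X - 2) choose (r - 2) < card {S \<in> \<A>. x \<in> S}"
    "\<And>x. x \<in> X \<Longrightarrow> (card X - 2) choose (r - 2) < card {S \<in> \<B>. x \<in> S}"
    by (auto simp: not_le)
  show False
  proof (cases "card \<B> \<le> card \<A>")
    case True
    then show False using cross_intersecting_degrees_le[OF assms deg] by blast
  next
    case False
    have "T \<inter> S \<noteq> {}" if "T \<in> \<B>" "S \<in> \<A>" for S T using assms(6) that by blast
    then show False
      using False cross_intersecting_degrees_le[OF assms(1,3,2,4,5) _ deg(2,1)] by (meson nat_le_linear)
  qed
qed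

subsection \<open>Sturdiness\<close>

lemma covering_number_attained:
  assumes "\<F> \<subseteq> k_subsets n k" "t_intersecting t \<F>"
  obtains T where "t_transversal n t \<F> T" "card T = covering_number n t \<F>"
    "\<And>S. t_transversal n t \<F> S \<Longrightarrow> covering_number n t \<F> \<le> card S"
proof -
  let ?Z = "{T. t_transversal n t \<F> T}"
  have "finite ?Z"
    by (rule finite_subset[of _ "Pow {1..n}"]) (auto simp: t_transversal_def)
  moreover have "{1..n} \<in> ?Z"
  proof -
    have "t \<le> card ({1..n} \<inter> A)" if "A \<in> \<F>" for A
    proof -
      have "{1..n} \<inter> A = A \<inter> A" using assms(1) that by (auto simp: k_subsets_def)
      then show ?thesis using assms(2) that by (metis t_intersecting_def)
    qed
    then show ?thesis by (simp add: t_transversal_def)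
  qed
  ultimately have "covering_number n t \<F> \<in> card ` ?Z"
    and min: "\<And>S. S \<in> ?Z \<Longrightarrow> covering_number n t \<F> \<le> card S"
    unfolding covering_number_def by (auto intro!: Min_in Min_le)
  then show ?thesis using that by auto
qed

lemma sturdiness_le:
  assumes "i \<in> {1..n}" "j \<in> {1..n}" "i \<noteq> j"
  shows "sturdiness n \<F> \<le> b \<F> i j"
proof -
  have "finite {b \<F> i j | i j. i \<in> {1..n} \<and> j \<in> {1..n} \<and> i \<noteq> j}"
    by (rule finite_subset[of _ "(\<lambda>(i, j). b \<F> i j) ` ({1..n} \<times> {1..n})"]) auto
  then show ?thesis unfolding sturdiness_def using assms by (intro Min_le) auto
qed

theorem theorem4p2:
  fixes n k t :: nat and \<F> :: "nat set set"
  assumes "\<F> \<subseteq> k_subsets n k"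
    and "t_intersecting t \<F>"
    and "covering_number n t \<F> = t + 1"
    and "int n \<ge> 2 * int k - int t + 2"
  shows "sturdiness n \<F> \<le> binom (int n - int t - 3) (int k - int t - 2)"
proof -
  obtain T where T: "t_transversal n t \<F> T" "card T = t + 1"
    and minimal: "\<And>S. t_transversal n t \<F> S \<Longrightarrow> t + 1 \<le> card S"
    using covering_number_attained[OF assms(1,2)] assms(3) by metis
  have T_sub: "T \<subseteq> {1..n}" and T_meets: "\<And>F. F \<in> \<F> \<Longrightarrow> t \<le> card (T \<inter> F)"
    using T by (auto simp: t_transversal_def)
  have fT: "finite T" using T_sub finite_subset by blast
  have F_sub: "F \<subseteq> {1..n}" and F_card: "card F = k" if "F \<in> \<F>" for F
    using assms(1) that by (auto simp: k_subsets_def)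
  have fF: "finite F" if "F \<in> \<F>" for F using F_sub[OF that] finite_subset by blast
  have "t \<ge> 1"
  proof (rule ccontr)
    assume "\<not> 1 \<le> t"
    then have "t_transversal n t \<F> {}" by (simp add: t_transversal_def)
    then show False using minimal by fastforce
  qed
  have "\<F> \<noteq> {}"
  proof
    assume "\<F> = {}"
    then have "t_transversal n t \<F> {}" by (simp add: t_transversal_def)
    then show False using minimal by fastforce
  qed
  then obtain F\<^sub>0 where "F\<^sub>0 \<in> \<F>" by blast
  then have "t_transversal n t \<F> F\<^sub>0"
    using F_sub assms(2) by (simp add: t_transversal_def t_intersecting_def)
  \<comment> \<open>A member of the family is itself a t-transversal, so it has at least t + 1
    elements.\<close>
  then have k: "t + 1 \<le> k" using minimal F_card \<open>F\<^sub>0 \<in> \<F>\<close> by metis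
  define X where "X = {1..n} - T"
  define trace where "trace i = (\<lambda>F. F - T) ` {F \<in> \<F>. i \<notin> F}" for i
  have X: "finite X" "card X = n - (t + 1)"
    using T_sub T(2) fT by (simp_all add: X_def card_Diff_subset)
  have large: "2 * (k - t) + 1 \<le> card X" using assms(4) k unfolding X(2) by linarith
  \<comment> \<open>F misses i but meets T in at least t of its t + 1 elements. Hence F is
    determined by F - T, and degrees of traces are the numbers \<open>b \<F> x i\<close>.\<close>
  have FT: "F \<inter> T = T - {i}" if "F \<in> \<F>" "i \<in> T" "i \<notin> F" for F i
  proof (rule card_seteq)
    show "card (T - {i}) \<le> card (F \<inter> T)"
      using T_meets[OF that(1)] T(2) that(2) fT by (simp add: Int_commute)
  qed (use fT that in auto)
  have trace_sub: "trace i \<subseteq> ksub X (k - t)" if i: "i \<in> T" for i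
  proof -
    have "F - T \<in> ksub X (k - t)" if "F \<in> \<F>" "i \<notin> F" for F
    proof -
      have "card (F \<inter> T) = t" using FT[OF that(1) i that(2)] T(2) i fT by simp
      then have "card (F - T) = k - t"
        using F_card[OF that(1)] fF[OF that(1)] by (simp add: card_Diff_subset_Int)
      then show ?thesis using F_sub[OF that(1)] by (auto simp: ksub_def X_def)
    qed
    then show ?thesis by (auto simp: trace_def)
  qed
  have trace_deg: "card {S \<in> trace i. x \<in> S} = b \<F> x i" if i: "i \<in> T" and x: "x \<in> X" for i x
  proof -
    have "{S \<in> trace i. x \<in> S} = (\<lambda>F. F - T) ` {F \<in> \<F>. x \<in> F \<and> i \<notin> F}"
      using x by (auto simp: trace_def X_def)
    moreover have "inj_on (\<lambda>F. F - T) {F \<in> \<F>. x \<in> F \<and> i \<notin> F}"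
      using FT[OF _ i] by (intro inj_onI) (metis (mono_tags, lifting) Int_Diff_Un mem_Collect_eq)
    ultimately show ?thesis by (simp add: card_image b_def)
  qed
  obtain i j where ij: "i \<in> T" "j \<in> T" "i \<noteq> j"
  proof -
    have "\<not> card T \<le> 1" using T(2) \<open>t \<ge> 1\<close> by simp
    then show ?thesis using that fT by (metis card_le_Suc0_iff_eq One_nat_def)
  qed
  have cross: "S \<inter> S' \<noteq> {}" if SS: "S \<in> trace i" "S' \<in> trace j" for S S'
  proof -
    obtain F F' where F: "F \<in> \<F>" "i \<notin> F" "S = F - T" and F': "F' \<in> \<F>" "j \<notin> F'" "S' = F' - T"
      using SS by (auto simp: trace_def)
    \<comment> \<open>Only t - 1 common elements lie in T, so F and F' must also meet outside
      T.\<close>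
    have "F \<inter> F' \<inter> T = T - {i} - {j}"
      using FT[OF F(1) ij(1) F(2)] FT[OF F'(1) ij(2) F'(2)] by blast
    then have "card (F \<inter> F' \<inter> T) < t"
      using T(2) ij fT \<open>t \<ge> 1\<close> by simp
    moreover have "t \<le> card (F \<inter> F')" using assms(2) F F' by (simp add: t_intersecting_def)
    ultimately have "\<not> F \<inter> F' \<subseteq> T" by (metis Int_absorb2 not_le)
    then show ?thesis using F F' by blast
  qed
  have sturdy: "sturdiness n \<F> \<le> card {S \<in> trace l. x \<in> S}" if "l \<in> T" "x \<in> X" for l x
    unfolding trace_deg[OF that] using that T_sub by (intro sturdiness_le) (auto simp: X_def)
  show ?thesis
  proof (cases "k - t = 1")
    case True
    have "card X > 1" using large True by simp
    then obtain x y where xy: "x \<in> X" "y \<in> X" "x \<noteq> y"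
      using X(1) by (metis card_le_Suc0_iff_eq One_nat_def not_le)
    \<comment> \<open>The lower entry of the bound is -1, so \<open>binom\<close> is 0. Traces are
      single points here; positive degrees at x in one trace family and at y in the other would give
      disjoint traces.\<close>
    have "sturdiness n \<F> = 0"
    proof (rule ccontr)
      assume "sturdiness n \<F> \<noteq> 0"
      then have "{S \<in> trace i. x \<in> S} \<noteq> {}" "{S \<in> trace j. y \<in> S} \<noteq> {}"
        using sturdy[OF ij(1) xy(1)] sturdy[OF ij(2) xy(2)] by (metis card.empty le_zero_eq)+
      then obtain S S' where S: "S \<in> trace i" "x \<in> S" and S': "S' \<in> trace j" "y \<in> S'" by blast
      have "card S = 1" "card S' = 1"
        using S S' trace_sub ij True by (auto simp: ksub_def)
      then have "S = {x}" "S' = {y}" using S S' by (metis card_1_singletonE singletonD)+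
      then show False using cross[OF S(1) S'(1)] xy(3) by simp
    qed
    then show ?thesis by simp
  next
    case False
    then have r: "2 \<le> k - t" using k by simp
    obtain x where "x \<in> X" and "card {S \<in> trace i. x \<in> S} \<le> (card X - 2) choose (k - t - 2)
        \<or> card {S \<in> trace j. x \<in> S} \<le> (card X - 2) choose (k - t - 2)"
      using cross_intersecting_min_degree[OF X(1) trace_sub[OF ij(1)] trace_sub[OF ij(2)] r large cross] by blast
    then have "sturdiness n \<F> \<le> (card X - 2) choose (k - t - 2)"
      using sturdy ij order_trans by blast
    also have "\<dots> = binom (int n - int t - 3) (int k - int t - 2)"
    proof -
      have "card X - 2 = nat (int n - int t - 3)" using X(2) by simp
      moreover have "k - t - 2 = nat (int k - int t - 2)" by simp
      ultimately show ?thesis using r by (simp add: binom_def)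
    qed
    finally show ?thesis .
  qed
qed

end
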